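(* Let $X$ be a separable Banach space with the approximation property, and let $T\in\mathcal B(K(X))$, where $K(X)$ denotes the ideal of compact operators on $X$ (with the operator norm). If $T$ is hypercyclic on $K(X)$, then $T$ is generalized numerically transitive on $K(X)$.
   Context: A bounded operator $T$ on a Banach space $Y$ is hypercyclic if there is $y\in Y$ such that $\{T^ny:n\ge0\}$ is dense in $Y$. For a Banach algebra $\mathcal A$ and $T\in\mathcal B(\mathcal A)$, put $\Theta_n:\mathcal A\times\mathcal A\to\mathcal A$, $\Theta_n(a,b)=a\,T^n(b)$ for $n\in\mathbb N$. $T$ is generalized numerically transitive if for all nonempty open sets $\widetilde O\subseteq\mathcal A\times\mathcal A$ (product topology) and $O\subseteq\mathcal A$ there is $n\in\mathbb N$ with $\Theta_n(\widetilde O)\cap O\neq\varnothing$. The algebra multiplication on $K(X)$ is composition. *)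

theory Defs
  imports "HOL-Analysis.Analysis"
begin

text \<open>
  Both real and complex Banach spaces are covered. The scalar field is a type
  \<open>'k :: {real_normed_field, euclidean_space}\<close>; by the Gelfand--Mazur theorem the only such
  fields are \<open>real\<close> and \<open>complex\<close>, up to isomorphism. A Banach space over \<open>'k\<close> is a type of class
  \<^class>\<open>banach\<close> (which provides the complete norm and the underlying real structure) with
  a scalar multiplication by \<open>'k\<close> that extends the real one and is compatible with the norm.
\<close>

locale banach_space_over = vector_space smul
  for smul :: "'k::{real_normed_field,euclidean_space} \<Rightarrow> 'a::banach \<Rightarrow> 'a" +
  assumes scale_of_real: "smul (of_real r) x = r *\<^sub>R x"
    and norm_scale: "norm (smul c x) = norm c * norm x"

lemma banach_space_over_real: "banach_space_over ((*\<^sub>R) :: real \<Rightarrow> 'a::banach \<Rightarrow> 'a)"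
  by unfold_locales (auto simp: algebra_simps)

lemma banach_space_over_self:
  "banach_space_over ((*) :: 'k \<Rightarrow> 'k \<Rightarrow> 'k::{real_normed_field,euclidean_space})"
  by unfold_locales (auto simp: algebra_simps norm_mult scaleR_conv_of_real)

text \<open>
  The type \<open>'a \<Rightarrow>\<^sub>L 'a\<close> consists of the bounded real-linear operators, with the operator norm;
  the bounded operators over \<open>'k\<close> are those that also commute with \<open>smul\<close>.
\<close>

definition bounded_operators ::
    "('k::{real_normed_field,euclidean_space} \<Rightarrow> 'a::banach \<Rightarrow> 'a) \<Rightarrow> ('a \<Rightarrow>\<^sub>L 'a) set" where
  "bounded_operators smul = {A. \<forall>c x. blinfun_apply A (smul c x) = smul c (blinfun_apply A x)}"

definition compact_operators ::
    "('k::{real_normed_field,euclidean_space} \<Rightarrow> 'a::banach \<Rightarrow> 'a) \<Rightarrow> ('a \<Rightarrow>\<^sub>L 'a) set" where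
  "compact_operators smul =
     {A \<in> bounded_operators smul. compact (closure (blinfun_apply A ` cball 0 1))}"

definition finite_rank_operators ::
    "('k::{real_normed_field,euclidean_space} \<Rightarrow> 'a::banach \<Rightarrow> 'a) \<Rightarrow> ('a \<Rightarrow>\<^sub>L 'a) set" where
  "finite_rank_operators smul =
     {A \<in> bounded_operators smul.
        \<exists>B. finite B \<and> range (blinfun_apply A) \<subseteq> module.span smul B}"

text \<open>Grothendieck's definition: on every compact set, the identity is a uniform limit of
  bounded operators of finite rank, with no bound on their norms.\<close>

definition approximation_property ::
    "('k::{real_normed_field,euclidean_space} \<Rightarrow> 'a::banach \<Rightarrow> 'a) \<Rightarrow> bool" where
  "approximation_property smul \<longleftrightarrow>
     (\<forall>K e. compact K \<and> e > 0 \<longrightarrow>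
        (\<exists>F \<in> finite_rank_operators smul. \<forall>x\<in>K. norm (blinfun_apply F x - x) < e))"

definition blinfun_scale ::
    "('k::{real_normed_field,euclidean_space} \<Rightarrow> 'a::banach \<Rightarrow> 'a) \<Rightarrow> 'k \<Rightarrow> ('a \<Rightarrow>\<^sub>L 'a) \<Rightarrow> ('a \<Rightarrow>\<^sub>L 'a)" where
  "blinfun_scale smul c A = Blinfun (\<lambda>x. smul c (blinfun_apply A x))"

lemma (in banach_space_over) bounded_linear_scale: "bounded_linear (smul c)"
proof (rule bounded_linear_intro)
  show "smul c (x + y) = smul c x + smul c y" for x y
    by (rule scale_right_distrib)
  show "smul c (r *\<^sub>R x) = r *\<^sub>R smul c x" for r x
    by (simp add: scale_of_real[symmetric] mult.commute)
  show "norm (smul c x) \<le> norm x * norm c" for x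
    by (simp add: norm_scale mult.commute)
qed

lemma (in banach_space_over) blinfun_scale_apply:
  "blinfun_apply (blinfun_scale smul c A) x = smul c (blinfun_apply A x)"
  unfolding blinfun_scale_def
  by (subst bounded_linear_Blinfun_apply)
    (auto intro: bounded_linear_compose[OF bounded_linear_scale blinfun.bounded_linear_right])

text \<open>
  \<open>K(X)\<close> is a subset of the type \<open>'a \<Rightarrow>\<^sub>L 'a\<close>, so the notions below are relative to a subset \<open>Y\<close>
  of a normed space, carrying the induced norm and topology. The values of \<open>T\<close> outside \<open>Y\<close> are
  irrelevant, because \<open>T\<close> maps \<open>Y\<close> into itself.
\<close>

definition bounded_operator_on ::
    "('k \<Rightarrow> 'b::real_normed_vector \<Rightarrow> 'b) \<Rightarrow> 'b set \<Rightarrow> ('b \<Rightarrow> 'b) \<Rightarrow> bool" where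
  "bounded_operator_on smul Y T \<longleftrightarrow>
     T \<in> Y \<rightarrow> Y \<and>
     (\<forall>x\<in>Y. \<forall>y\<in>Y. T (x + y) = T x + T y) \<and>
     (\<forall>c. \<forall>x\<in>Y. T (smul c x) = smul c (T x)) \<and>
     (\<exists>C. \<forall>x\<in>Y. norm (T x) \<le> C * norm x)"

definition hypercyclic_on :: "'b::real_normed_vector set \<Rightarrow> ('b \<Rightarrow> 'b) \<Rightarrow> bool" where
  "hypercyclic_on Y T \<longleftrightarrow> (\<exists>y\<in>Y. Y \<subseteq> closure {(T ^^ n) y | n. n \<ge> 0})"

definition Theta :: "('b \<Rightarrow> 'b \<Rightarrow> 'b) \<Rightarrow> ('b \<Rightarrow> 'b) \<Rightarrow> nat \<Rightarrow> 'b \<times> 'b \<Rightarrow> 'b" where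
  "Theta amul T n = (\<lambda>(a, b). amul a ((T ^^ n) b))"

text \<open>
  The algebra multiplication \<open>amul\<close> is a parameter, since \<open>'a \<Rightarrow>\<^sub>L 'a\<close> is not an instance of the
  type classes for algebras. The index \<open>n\<close> ranges over the positive integers; this is the
  stronger of the two conventions for the natural numbers here.
\<close>

definition generalized_numerically_transitive ::
    "('b::real_normed_vector \<Rightarrow> 'b \<Rightarrow> 'b) \<Rightarrow> 'b set \<Rightarrow> ('b \<Rightarrow> 'b) \<Rightarrow> bool" where
  "generalized_numerically_transitive amul Y T \<longleftrightarrow>
     (\<forall>V W. openin (prod_topology (top_of_set Y) (top_of_set Y)) V \<and> V \<noteq> {} \<and>
            openin (top_of_set Y) W \<and> W \<noteq> {} \<longrightarrow>
        (\<exists>n\<ge>1. Theta amul T n ` V \<inter> W \<noteq> {}))"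

end

theory Submission
  imports Defs
begin

text \<open>
  It suffices to find, for compact \<open>a\<close> and \<open>w\<close>, compact \<open>a'\<close> near \<open>a\<close> and \<open>c\<close> with \<open>a' c\<close> near \<open>w\<close>:
  since \<open>K(X)\<close> has no isolated points unless it is \<open>{0}\<close>, the orbit of a hypercyclic vector \<open>y\<close>
  comes near the second component at some time \<open>m\<close> and near \<open>c\<close> at some later time \<open>k\<close>, and
  \<open>n = k - m\<close> works. By the approximation property, \<open>a\<close> is close to an operator \<open>a\<^sub>0\<close> of finite
  rank. Choose first \<open>F\<close> of finite rank, close to the identity on the images of the unit ball under
  \<open>a\<^sub>0\<close> and \<open>w\<close>, and only then a scalar \<open>t\<close> so small that \<open>t F\<close> is negligible (no bound on
  the norm of \<open>F\<close> is needed) and such that \<open>a\<^sub>0 - t\<close> is invertible. Then \<open>a' = F (a\<^sub>0 - t)\<close> and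
  \<open>c = (a\<^sub>0 - t)\<^sup>-\<^sup>1 w\<close> satisfy \<open>a' c = F w\<close>, which is close to \<open>w\<close>.
\<close>

context banach_space_over
begin

section \<open>Compactness of balls in finite-dimensional subspaces\<close>

text \<open>Induction on \<open>B\<close>: in \<open>x + smul c b\<close> the coefficient
  \<open>c\<close> is controlled by the distance of \<open>b\<close> from \<open>span B\<close>, so
  the ball lies in a continuous image of a product of two compact sets. Compactness of balls in
  \<open>'k\<close> enters through the class \<open>euclidean_space\<close>.\<close>

lemma compact_span_Int_cball:
  assumes "finite B"
  shows "compact (span B \<inter> cball 0 r)"
  using assms
proof (induction B arbitrary: r)
  case empty
  then show ?case by (simp add: finite_imp_compact)
next
  case (insert b B)
  \<comment> \<open>A convergent sequence is bounded, so it stays in one ball of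
    \<open>span B\<close>, which is compact by induction. This is why the radius is
    generalized.\<close>
  have "closed (span B)"
    unfolding closed_sequential_limits
  proof (intro allI impI, elim conjE)
    fix f l assume f: "\<forall>n. f n \<in> span B" "f \<longlonglongrightarrow> l"
    then obtain r where "\<And>n. norm (f n) \<le> r"
      using convergent_imp_bounded[of f l] unfolding bounded_iff by blast
    then have "\<forall>n. f n \<in> span B \<inter> cball 0 r" using f by auto
    then have "l \<in> span B \<inter> cball 0 r"
      using compact_imp_closed[OF insert.IH] f(2) closed_sequentially by blast
    then show "l \<in> span B" by simp
  qed
  show ?case
  proof (cases "b \<in> span B")
    case True
    then show ?thesis using insert.IH by (simp add: span_redundant)
  next
    case False
    have ne: "span B \<noteq> {}" using span_zero by blast
    define d where "d = infdist b (span B)"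
    have d: "d > 0"
      using False \<open>closed (span B)\<close> ne in_closed_iff_infdist_zero[of "span B" b] infdist_nonneg[of b "span B"]
      unfolding d_def by linarith
    \<comment> \<open>Dividing by \<open>c\<close> turns \<open>x + smul c b\<close> into
      \<open>b\<close> minus a vector of \<open>span B\<close>, whose norm is at least
      \<open>d\<close>.\<close>
    have coeff_le: "norm c * d \<le> norm (x + smul c b)" if x: "x \<in> span B" for c x
    proof (cases "c = 0")
      case False
      have "d \<le> dist b (smul (- inverse c) x)"
        unfolding d_def by (rule infdist_le) (use x span_scale in blast)
      also have "\<dots> = norm (smul (inverse c) (x + smul c b))"
        using False by (simp add: dist_norm scale_right_distrib add.commute)
      also have "\<dots> = norm (x + smul c b) / norm c"
        by (simp add: norm_scale norm_inverse divide_inverse mult.commute)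
      finally show ?thesis using False by (simp add: field_simps)
    qed simp
    \<comment> \<open>For \<open>norm y \<le> r\<close>, \<open>coeff_le\<close> gives
      \<open>norm c \<le> r / d\<close>, and then the triangle inequality gives the radius for the
      component in \<open>span B\<close>. \<open>M\<close> may leave the ball, hence the
      intersection below.\<close>
    define M where "M = (\<lambda>(x, c). x + smul c b) `
      ((span B \<inter> cball 0 (r + r / d * norm b)) \<times> cball 0 (r / d))"
    have "bounded_linear (\<lambda>c. smul c b)"
      by (rule bounded_linear_intro[of _ "norm b"])
        (simp_all add: scale_left_distrib norm_scale scaleR_conv_of_real scale_of_real
          flip: scale_scale)
    then have "continuous_on U (\<lambda>p. fst p + smul (snd p) b)" for U
      by (intro continuous_on_add continuous_on_fst continuous_on_id
          bounded_linear.continuous_on[of "\<lambda>c. smul c b"] continuous_on_snd)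
    then have "compact M"
      unfolding M_def case_prod_unfold
      by (rule compact_continuous_image) (rule compact_Times[OF insert.IH compact_cball])
    moreover have "span (insert b B) \<inter> cball 0 r = M \<inter> cball 0 r"
    proof (intro equalityI subsetI)
      fix y assume y: "y \<in> span (insert b B) \<inter> cball 0 r"
      then obtain c where c: "y - smul c b \<in> span B"
        by (auto simp: span_insert)
      have nc: "norm c * d \<le> norm y" using coeff_le[OF c, of c] by simp
      then have "norm c \<le> r / d" using y d by (simp add: field_simps)
      moreover have "norm (y - smul c b) \<le> norm y + norm c * norm b"
        using norm_triangle_ineq4[of y "smul c b"] by (simp add: norm_scale)
      ultimately have "norm (y - smul c b) \<le> r + r / d * norm b"
        using y mult_right_mono[of "norm c" "r / d" "norm b"] by auto
      then have "(y - smul c b, c) \<in> (span B \<inter> cball 0 (r + r / d * norm b)) \<times> cball 0 (r / d)"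
        using c \<open>norm c \<le> r / d\<close> by auto
      then have "y \<in> M" unfolding M_def
        by (intro image_eqI[where x="(y - smul c b, c)"]) auto
      then show "y \<in> M \<inter> cball 0 r" using y by auto
    next
      fix y assume y: "y \<in> M \<inter> cball 0 r"
      then obtain x c where "x \<in> span B" "y = x + smul c b"
        unfolding M_def by auto
      then have "y - smul c b \<in> span B" by simp
      then show "y \<in> span (insert b B) \<inter> cball 0 r"
        using y unfolding span_insert by blast
    qed
    ultimately show ?thesis by auto
  qed
qed

section \<open>Compact operators as an ideal\<close>

lemma bounded_operators_apply:
  "A \<in> bounded_operators smul \<Longrightarrow> A (smul c x) = smul c (A x)"
  by (simp add: bounded_operators_def)

lemma bounded_operators_compose:
  "A \<in> bounded_operators smul \<Longrightarrow> B \<in> bounded_operators smul \<Longrightarrow> A o\<^sub>L B \<in> bounded_operators smul"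
  by (simp add: bounded_operators_def)

lemma bounded_operators_add:
  "A \<in> bounded_operators smul \<Longrightarrow> B \<in> bounded_operators smul \<Longrightarrow> A + B \<in> bounded_operators smul"
  by (simp add: bounded_operators_def blinfun.add_left scale_right_distrib)

lemma bounded_operators_diff:
  "A \<in> bounded_operators smul \<Longrightarrow> B \<in> bounded_operators smul \<Longrightarrow> A - B \<in> bounded_operators smul"
  by (simp add: bounded_operators_def blinfun.diff_left scale_right_diff_distrib)

lemma bounded_operators_scale:
  "A \<in> bounded_operators smul \<Longrightarrow> blinfun_scale smul c A \<in> bounded_operators smul"
  by (simp add: bounded_operators_def blinfun_scale_apply mult.commute)

lemma bounded_operators_id: "id_blinfun \<in> bounded_operators smul"
  by (simp add: bounded_operators_def)

lemma compact_operatorsI: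
  assumes "A \<in> bounded_operators smul" and "compact M" and "A ` cball 0 1 \<subseteq> M"
  shows "A \<in> compact_operators smul"
proof -
  have "closure (A ` cball 0 1) \<subseteq> M"
    by (simp add: assms closure_minimal compact_imp_closed)
  then have "compact (closure (A ` cball 0 1))"
    using assms(2) compact_Int_closed[of M "closure (A ` cball 0 1)"] by (simp add: Int_absorb1)
  then show ?thesis using assms(1) by (simp add: compact_operators_def)
qed

lemma compact_operators_bounded: "A \<in> compact_operators smul \<Longrightarrow> A \<in> bounded_operators smul"
  by (simp add: compact_operators_def)

lemma compact_operators_compact:
  "A \<in> compact_operators smul \<Longrightarrow> compact (closure (blinfun_apply A ` cball 0 1))"
  by (simp add: compact_operators_def)

lemma compact_operators_compose_left:
  assumes "A \<in> bounded_operators smul" "B \<in> compact_operators smul"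
  shows "A o\<^sub>L B \<in> compact_operators smul"
proof (rule compact_operatorsI)
  show "A o\<^sub>L B \<in> bounded_operators smul"
    using assms by (simp add: bounded_operators_compose compact_operators_bounded)
  show "compact (A ` closure (B ` cball 0 1))"
    using compact_operators_compact[OF assms(2)]
    by (rule compact_continuous_image[rotated]) (intro continuous_intros)
  show "(A o\<^sub>L B) ` cball 0 1 \<subseteq> A ` closure (B ` cball 0 1)"
    using closure_subset[of "B ` cball 0 1"] by auto
qed

lemma compact_operators_compose_right:
  assumes "A \<in> compact_operators smul" "B \<in> bounded_operators smul"
  shows "A o\<^sub>L B \<in> compact_operators smul"
proof (rule compact_operatorsI)
  \<comment> \<open>\<open>B\<close> maps the unit ball into the ball of radius \<open>r\<close>;
    the summand 1 keeps \<open>r\<close> positive when \<open>B = 0\<close>.\<close>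
  define r where "r = norm B + 1"
  have r: "r > 0" using norm_ge_zero[of B] unfolding r_def by linarith
  show "A o\<^sub>L B \<in> bounded_operators smul"
    using assms by (simp add: bounded_operators_compose compact_operators_bounded)
  show "compact ((\<lambda>x. r *\<^sub>R x) ` closure (A ` cball 0 1))"
    using compact_operators_compact[OF assms(1)] by (rule compact_scaling)
  show "(A o\<^sub>L B) ` cball 0 1 \<subseteq> (\<lambda>x. r *\<^sub>R x) ` closure (A ` cball 0 1)"
  proof
    fix y assume "y \<in> (A o\<^sub>L B) ` cball 0 1"
    then obtain x where x: "norm x \<le> 1" "y = A (B x)" by auto
    have "norm (B x) \<le> norm B * norm x" by (rule norm_blinfun)
    also have "\<dots> \<le> norm B" using x(1) by (simp add: mult_left_le)
    finally have "norm (B x /\<^sub>R r) \<le> 1"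
      using r unfolding r_def by (simp add: field_simps)
    then have "A (B x /\<^sub>R r) \<in> closure (A ` cball 0 1)"
      using closure_subset[of "A ` cball 0 1"] by auto
    moreover have "y = r *\<^sub>R A (B x /\<^sub>R r)"
      using r x(2) by (simp add: blinfun.scaleR_right)
    ultimately show "y \<in> (\<lambda>x. r *\<^sub>R x) ` closure (A ` cball 0 1)" by blast
  qed
qed

lemma compact_operators_add:
  assumes "A \<in> compact_operators smul" "B \<in> compact_operators smul"
  shows "A + B \<in> compact_operators smul"
proof (rule compact_operatorsI)
  show "A + B \<in> bounded_operators smul"
    using assms by (simp add: bounded_operators_add compact_operators_bounded)
  show "compact {x + y | x y. x \<in> closure (A ` cball 0 1) \<and> y \<in> closure (B ` cball 0 1)}"
    using assms by (intro compact_sums compact_operators_compact)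
  show "(A + B) ` cball 0 1
      \<subseteq> {x + y | x y. x \<in> closure (A ` cball 0 1) \<and> y \<in> closure (B ` cball 0 1)}"
    using closure_subset[of "A ` cball 0 1"] closure_subset[of "B ` cball 0 1"]
    by (fastforce simp: blinfun.add_left)
qed

lemma compact_operators_scaleR:
  assumes "A \<in> compact_operators smul"
  shows "t *\<^sub>R A \<in> compact_operators smul"
proof -
  have "t *\<^sub>R A = blinfun_scale smul (of_real t) id_blinfun o\<^sub>L A"
    by (rule blinfun_eqI) (simp add: blinfun_scale_apply scale_of_real blinfun.scaleR_left)
  then show ?thesis
    using compact_operators_compose_left[OF bounded_operators_scale[OF bounded_operators_id] assms]
    by simp
qed

lemma finite_rank_imp_compact:
  assumes "A \<in> finite_rank_operators smul"
  shows "A \<in> compact_operators smul"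
proof -
  obtain B where B: "finite B" "range A \<subseteq> span B"
    using assms by (auto simp: finite_rank_operators_def)
  show ?thesis
  proof (rule compact_operatorsI)
    show "A \<in> bounded_operators smul" using assms by (simp add: finite_rank_operators_def)
    show "compact (span B \<inter> cball 0 (norm A))" using B(1) by (rule compact_span_Int_cball)
    have "norm (A x) \<le> norm A" if "norm x \<le> 1" for x
      using norm_blinfun[of A x] mult_left_le[of "norm x" "norm A"] that by simp
    then show "A ` cball 0 1 \<subseteq> span B \<inter> cball 0 (norm A)" using B(2) by auto
  qed
qed

text \<open>A small nonzero multiple of \<open>D\<close>, of norm \<open>e / 2\<close>, is added to
  \<open>A\<close>. Absence of isolated points is what makes a dense orbit return near a given
  operator at arbitrarily late times.\<close>

lemma islimpt_compact_operators:
  assumes "A \<in> compact_operators smul" "D \<in> compact_operators smul" "D \<noteq> 0"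
  shows "A islimpt compact_operators smul"
  unfolding islimpt_approachable
proof (intro allI impI)
  fix e :: real assume e: "e > 0"
  define t where "t = e / (2 * norm D)"
  have "A + t *\<^sub>R D \<in> compact_operators smul"
    using assms by (intro compact_operators_add compact_operators_scaleR)
  moreover have "A + t *\<^sub>R D \<noteq> A" "dist (A + t *\<^sub>R D) A < e"
    using e assms(3) by (auto simp: t_def dist_norm)
  ultimately show "\<exists>x'\<in>compact_operators smul. x' \<noteq> A \<and> dist x' A < e" by blast
qed

section \<open>Invertibility of \<open>A - z\<close> for \<open>A\<close> of finite rank\<close>

text \<open>
  Inverses of \<open>A - z\<close> are built as polynomials in \<open>A\<close>, so that they are bounded, commute with
  \<open>smul\<close> and with each other; membership in the bicommutant records just that.
\<close>

definition bicommutant :: "('a \<Rightarrow>\<^sub>L 'a) \<Rightarrow> ('a \<Rightarrow>\<^sub>L 'a) set" where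
  "bicommutant A = {R. \<forall>S\<in>bounded_operators smul.
     (\<forall>x. S (A x) = A (S x)) \<longrightarrow> (\<forall>x. blinfun_apply R (S x) = S (blinfun_apply R x))}"

lemma bicommutant_self: "A \<in> bicommutant A"
  by (simp add: bicommutant_def)

lemma bicommutant_id: "id_blinfun \<in> bicommutant A"
  by (simp add: bicommutant_def)

lemma bicommutant_scale: "R \<in> bicommutant A \<Longrightarrow> blinfun_scale smul c R \<in> bicommutant A"
  by (simp add: bicommutant_def blinfun_scale_apply bounded_operators_apply)

lemma bicommutant_add: "R \<in> bicommutant A \<Longrightarrow> S \<in> bicommutant A \<Longrightarrow> R + S \<in> bicommutant A"
  by (simp add: bicommutant_def blinfun.add_left blinfun.add_right)

lemma bicommutant_diff: "R \<in> bicommutant A \<Longrightarrow> S \<in> bicommutant A \<Longrightarrow> R - S \<in> bicommutant A"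
  by (simp add: bicommutant_def blinfun.diff_left blinfun.diff_right)

lemma bicommutant_compose:
  "R \<in> bicommutant A \<Longrightarrow> S \<in> bicommutant A \<Longrightarrow> R o\<^sub>L S \<in> bicommutant A"
  by (simp add: bicommutant_def)

lemma bicommutant_zero: "0 \<in> bicommutant A"
  by (simp add: bicommutant_def)

text \<open>Multiplication by a scalar \<open>c\<close> is itself a bounded operator commuting with
  \<open>A\<close>, so \<open>R\<close> commutes with it.\<close>

lemma bicommutant_bounded:
  assumes "A \<in> bounded_operators smul" "R \<in> bicommutant A"
  shows "R \<in> bounded_operators smul"
proof -
  have "R (smul c x) = smul c (R x)" for c x
  proof -
    let ?S = "blinfun_scale smul c id_blinfun"
    have "?S \<in> bounded_operators smul" "\<forall>x. ?S (A x) = A (?S x)"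
      using assms(1) bounded_operators_scale[OF bounded_operators_id]
      by (auto simp: blinfun_scale_apply bounded_operators_apply)
    then have "R (?S x) = ?S (R x)" using assms(2) by (auto simp: bicommutant_def)
    then show ?thesis by (simp add: blinfun_scale_apply)
  qed
  then show ?thesis by (simp add: bounded_operators_def)
qed

text \<open>Since \<open>A\<close> commutes with itself, \<open>S\<close> commutes with
  \<open>A\<close>; hence \<open>S\<close> is one of the operators with which \<open>R\<close> must
  commute.\<close>

lemma bicommutant_commute:
  assumes "A \<in> bounded_operators smul" "R \<in> bicommutant A" "S \<in> bicommutant A"
  shows "R (S x) = S (R x)"
  using assms bicommutant_bounded[OF assms(1) assms(3)] unfolding bicommutant_def by auto

text \<open>\<open>Q\<close> is the quotient of \<open>X^i - z^i\<close> by \<open>X - z\<close>,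
  evaluated at \<open>A\<close>. The recursion is
  \<open>X^(i+1) - z^(i+1) = X (X^i - z^i) + z^i (X - z)\<close>.\<close>

lemma ex_quotient_power:
  "\<exists>Q\<in>bicommutant A. \<forall>x. A (Q x) - smul z (Q x) = (blinfun_apply A ^^ i) x - smul (z ^ i) x"
  if A: "A \<in> bounded_operators smul"
proof (induction i)
  case 0
  then show ?case by (auto intro!: bexI[of _ 0] bicommutant_zero)
next
  case (Suc i)
  then obtain Q where Q: "Q \<in> bicommutant A"
    "\<And>x. A (Q x) - smul z (Q x) = (blinfun_apply A ^^ i) x - smul (z ^ i) x" by blast
  define Q' where "Q' = (A o\<^sub>L Q) + blinfun_scale smul (z ^ i) id_blinfun"
  have "Q' \<in> bicommutant A" unfolding Q'_def
    by (intro bicommutant_add bicommutant_compose bicommutant_scale bicommutant_self bicommutant_id Q)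
  moreover have "A (Q' x) - smul z (Q' x) = (blinfun_apply A ^^ Suc i) x - smul (z ^ Suc i) x" for x
  proof -
    have "A (Q' x) - smul z (Q' x)
      = A (A (Q x) - smul z (Q x)) + (A (smul (z ^ i) x) - smul z (smul (z ^ i) x))"
      by (simp add: Q'_def blinfun.add_left blinfun.add_right blinfun.diff_right
          blinfun_scale_apply scale_right_distrib bounded_operators_apply[OF A])
    also have "\<dots> = (blinfun_apply A ^^ Suc i) x - smul (z ^ Suc i) x"
      by (simp add: Q(2) blinfun.diff_right)
    finally show ?thesis .
  qed
  ultimately show ?case by blast
qed

lemma ex_quotient_polynomial:
  "\<exists>Q\<in>bicommutant A. \<forall>x. A (Q x) - smul z (Q x)
     = (\<Sum>i\<le>n. smul (c i) ((blinfun_apply A ^^ i) x)) - smul (\<Sum>i\<le>n. c i * z ^ i) x"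
  if A: "A \<in> bounded_operators smul" for n :: nat
proof -
  obtain Q where Q: "\<And>i. Q i \<in> bicommutant A"
    "\<And>i x. A (Q i x) - smul z (Q i x) = (blinfun_apply A ^^ i) x - smul (z ^ i) x"
    using ex_quotient_power[OF A] by metis
  \<comment> \<open>\<open>p(A) - p(z)\<close> is divisible by \<open>A - z\<close>, for \<open>p\<close> with coefficients \<open>c\<close>.\<close>
  define P where "P = (\<Sum>i\<le>n. blinfun_scale smul (c i) (Q i))"
  have "P \<in> bicommutant A"
    unfolding P_def
    by (induction n) (auto intro: bicommutant_add bicommutant_scale Q)
  moreover have "A (P x) - smul z (P x)
     = (\<Sum>i\<le>n. smul (c i) ((blinfun_apply A ^^ i) x)) - smul (\<Sum>i\<le>n. c i * z ^ i) x" for x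
  proof -
    have "A (P x) - smul z (P x) = (\<Sum>i\<le>n. smul (c i) (A (Q i x) - smul z (Q i x)))"
      by (simp add: P_def blinfun.sum_left blinfun.sum_right blinfun_scale_apply scale_sum_right
          bounded_operators_apply[OF A] scale_right_diff_distrib sum_subtractf mult.commute)
    then show ?thesis
      by (simp add: Q(2) scale_right_diff_distrib sum_subtractf scale_sum_left)
  qed
  ultimately show ?thesis by blast
qed

text \<open>The \<open>card B + 1\<close> vectors \<open>f 0, ..., f (card B)\<close> lie in a span
  of \<open>card B\<close> vectors. Indexed coefficients are needed to form a polynomial, whereas
  \<open>dependent\<close> speaks of sets, so repetitions among the \<open>f i\<close> are a
  separate case.\<close>

lemma krylov_dependent:
  assumes B: "finite B" and sp: "\<And>i. (f :: nat \<Rightarrow> 'a) i \<in> span B"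
  obtains n :: nat and c where "\<exists>i\<le>n. c i \<noteq> 0" "(\<Sum>i\<le>n. smul (c i) (f i)) = 0"
proof (cases "inj_on f {..card B}")
  case True
  have "dependent (f ` {..card B})"
  proof (rule ccontr)
    assume "\<not> dependent (f ` {..card B})"
    then have "card (f ` {..card B}) \<le> card B"
      using independent_span_bound[OF B] sp by blast
    then show False using True by (simp add: card_image)
  qed
  then obtain u where u: "\<exists>v\<in>f ` {..card B}. u v \<noteq> 0" "(\<Sum>v\<in>f ` {..card B}. smul (u v) v) = 0"
    by (auto simp: dependent_finite)
  show ?thesis
    by (rule that[of "card B" "\<lambda>i. u (f i)"])
      (use u True in \<open>auto simp: sum.reindex\<close>)
next
  case False
  then obtain i j where ij: "i \<le> card B" "j \<le> card B" "i \<noteq> j" "f i = f j"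
    by (auto simp: inj_on_def)
  show ?thesis
  \<comment> \<open>A repeated vector gives the relation \<open>f i - f j = 0\<close>.\<close>
  proof (rule that[of "card B" "\<lambda>k. (if k = i then 1 else 0) - (if k = j then 1 else 0)"])
    show "\<exists>k\<le>card B. (if k = i then 1 else 0) - (if k = j then 1 else 0) \<noteq> (0 :: 'k)"
      using ij by (intro exI[of _ i]) auto
    show "(\<Sum>k\<le>card B. smul ((if k = i then 1 else 0) - (if k = j then 1 else 0)) (f k)) = 0"
      using ij by (simp add: scale_left_diff_distrib sum_subtractf if_distrib[of "\<lambda>c. smul c _"]
          cong: if_cong)
  qed
qed

text \<open>Some nonzero polynomial \<open>p\<close> satisfies \<open>p(A) v = 0\<close>. Writing
  \<open>p(A) - p(z) = (A - z) Q\<close> and applying this to \<open>v\<close> gives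
  \<open>(A - z) Q v = - p(z) v\<close>, so every exceptional \<open>z\<close> is a root of
  \<open>p\<close>.\<close>

lemma finite_no_local_inverse:
  assumes A: "A \<in> bounded_operators smul" and B: "finite B" "range A \<subseteq> span B" and v: "v \<in> span B"
  shows "finite {z. \<not> (\<exists>R\<in>bicommutant A. A (R v) - smul z (R v) = v)}"
proof -
  have "(blinfun_apply A ^^ i) v \<in> span B" for i
    using B(2) v by (cases i) auto
  then obtain n c where c: "\<exists>i\<le>n. c i \<noteq> 0"
    "(\<Sum>i\<le>n. smul (c i) ((blinfun_apply A ^^ i) v)) = 0"
    by (rule krylov_dependent[OF B(1), of "\<lambda>i. (blinfun_apply A ^^ i) v"])
  have "finite {z. (\<Sum>i\<le>n. c i * z ^ i) = 0}"
    using c(1) polyfun_finite_roots[of c n] by (rule iffD2[rotated])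
  moreover have "\<exists>R\<in>bicommutant A. A (R v) - smul z (R v) = v"
    if z: "(\<Sum>i\<le>n. c i * z ^ i) \<noteq> 0" for z
  proof -
    let ?p = "\<Sum>i\<le>n. c i * z ^ i"
    obtain Q where Q: "Q \<in> bicommutant A" "\<And>x. A (Q x) - smul z (Q x)
       = (\<Sum>i\<le>n. smul (c i) ((blinfun_apply A ^^ i) x)) - smul ?p x"
      using ex_quotient_polynomial[OF A] by blast
    define R where "R = blinfun_scale smul (- inverse ?p) Q"
    have "A (R v) - smul z (R v) = smul (- inverse ?p) (A (Q v) - smul z (Q v))"
      by (simp only: R_def blinfun_scale_apply bounded_operators_apply[OF A] scale_right_diff_distrib
          scale_scale mult.commute)
    also have "\<dots> = v" using Q(2)[of v] c(2) z by simp
    finally show ?thesis using Q(1) bicommutant_scale unfolding R_def by blast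
  qed
  ultimately show ?thesis by (elim finite_subset[rotated]) blast
qed

text \<open>The inverses for single vectors are merged one vector of \<open>B\<close> at a time;
  linearity then extends the result to \<open>span B\<close>.\<close>

lemma ex_common_local_inverse:
  assumes A: "A \<in> bounded_operators smul" and "finite B"
    and "\<And>v. v \<in> B \<Longrightarrow> \<exists>R\<in>bicommutant A. A (R v) - smul z (R v) = v"
  shows "\<exists>R\<in>bicommutant A. \<forall>v\<in>B. A (R v) - smul z (R v) = v"
  using assms(2,3)
proof (induction B)
  case empty
  show ?case using bicommutant_zero by blast
next
  case (insert b B)
  define L where "L = A - blinfun_scale smul z id_blinfun"
  have L: "L x = A x - smul z x" for x
    by (simp add: L_def blinfun.diff_left blinfun_scale_apply)
  have LC: "L \<in> bicommutant A" unfolding L_def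
    by (intro bicommutant_diff bicommutant_scale bicommutant_self bicommutant_id)
  obtain R where R: "R \<in> bicommutant A" "\<And>v. v \<in> B \<Longrightarrow> L (R v) = v"
    using insert.IH insert.prems unfolding L by blast
  obtain S where S: "S \<in> bicommutant A" "L (S b) = b"
    using insert.prems unfolding L by blast
  \<comment> \<open>\<open>I - L U = (I - L R) (I - L S)\<close>, and the two factors commute.\<close>
  define U where "U = R + S - (L o\<^sub>L (R o\<^sub>L S))"
  note comm = bicommutant_commute[OF A]
  have "U \<in> bicommutant A" unfolding U_def
    by (intro bicommutant_add bicommutant_diff bicommutant_compose R S LC)
  moreover have "L (U v) = v" if "v \<in> insert b B" for v
  proof -
    have U1: "L (U v) = L (R v) + L (S v) - L (L (R (S v)))"
      by (simp add: U_def blinfun.diff_left blinfun.add_left blinfun.diff_right blinfun.add_right)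
    show ?thesis
    proof (cases "v = b")
      case True
      then show ?thesis using U1 S(2) comm[OF LC R(1)] by simp
    next
      case False
      then have "L (R v) = v" using R(2) that by blast
      then show ?thesis using U1 comm[OF LC S(1)] comm[OF R(1) S(1)] by simp
    qed
  qed
  ultimately show ?case unfolding L by blast
qed

text \<open>Apart from 0 and the finitely many exceptional scalars of the vectors in
  \<open>B\<close>, \<open>A - z\<close> has a right inverse on \<open>span B\<close>. As
  \<open>A\<close> maps into \<open>span B\<close>, this extends to the whole space after a division
  by \<open>z\<close>.\<close>

lemma finite_no_right_inverse:
  assumes "A \<in> finite_rank_operators smul"
  shows "finite {z. \<not> (\<exists>R\<in>bounded_operators smul. \<forall>x. A (R x) - smul z (R x) = x)}"
proof -
  obtain B where A: "A \<in> bounded_operators smul" and B: "finite B" "range A \<subseteq> span B"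
    using assms by (auto simp: finite_rank_operators_def)
  let ?bad = "\<lambda>v. {z. \<not> (\<exists>R\<in>bicommutant A. A (R v) - smul z (R v) = v)}"
  have fin: "finite (insert 0 (\<Union>v\<in>B. ?bad v))"
    using B(1) finite_no_local_inverse[OF A B span_base]
    by (intro finite.insertI finite_UN_I)
  have ex: "\<exists>R\<in>bounded_operators smul. \<forall>x. A (R x) - smul z (R x) = x"
    if z: "z \<notin> insert 0 (\<Union>v\<in>B. ?bad v)" for z
  proof -
    obtain R where R: "R \<in> bicommutant A" "\<And>v. v \<in> B \<Longrightarrow> A (R v) - smul z (R v) = v"
      using ex_common_local_inverse[OF A B(1), of z] z by auto
    note Rb = bicommutant_bounded[OF A R(1)]
    have span: "A (R v) - smul z (R v) = v" if "v \<in> span B" for v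
      using that
    proof (induction rule: span_induct_alt)
      case base
      show ?case by simp
    next
      case (step c x y)
      have "A (R (smul c x + y)) - smul z (R (smul c x + y))
        = smul c (A (R x) - smul z (R x)) + (A (R y) - smul z (R y))"
        by (simp add: blinfun.add_right bounded_operators_apply[OF A] bounded_operators_apply[OF Rb]
            scale_right_distrib scale_right_diff_distrib mult.commute)
      then show ?case using R(2)[OF step(1)] step(2) by simp
    qed
    \<comment> \<open>\<open>(A - z) R A = A\<close>, hence \<open>(A - z) (R A - I) = z\<close>.\<close>
    define S where "S = blinfun_scale smul (inverse z) ((R o\<^sub>L A) - id_blinfun)"
    have "S \<in> bounded_operators smul" unfolding S_def
      by (intro bounded_operators_scale bounded_operators_diff bounded_operators_compose
          bounded_operators_id A Rb)
    moreover have "A (S x) - smul z (S x) = x" for x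
    proof -
      have "A (S x) - smul z (S x)
        = smul (inverse z) ((A (R (A x)) - smul z (R (A x))) - A x + smul z x)"
        using z by (simp add: S_def blinfun_scale_apply blinfun.diff_left blinfun.diff_right
            bounded_operators_apply[OF A] scale_right_diff_distrib scale_right_distrib mult.commute)
      also have "A (R (A x)) - smul z (R (A x)) = A x"
        using span[of "A x"] B(2) by blast
      also have "smul (inverse z) (A x - A x + smul z x) = x" using z by simp
      finally show ?thesis .
    qed
    ultimately show ?thesis by blast
  qed
  show ?thesis
  proof (rule finite_subset[OF _ fin], rule subsetI, rule ccontr)
    fix z
    assume "z \<in> {z. \<not> (\<exists>R\<in>bounded_operators smul. \<forall>x. A (R x) - smul z (R x) = x)}"
      and z: "z \<notin> insert 0 (\<Union>v\<in>B. ?bad v)"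
    then show False using ex[OF z] by (simp only: mem_Collect_eq not_True_eq_False)
  qed
qed

section \<open>Finite-rank approximation and approximate factorization\<close>

lemma finite_rank_compose:
  assumes "F \<in> finite_rank_operators smul" "A \<in> bounded_operators smul"
  shows "F o\<^sub>L A \<in> finite_rank_operators smul"
  using assms unfolding finite_rank_operators_def
  by (auto intro!: bounded_operators_compose)

text \<open>The approximation property is applied to the union of the closed images of the unit
  ball, so that a single \<open>F\<close> serves both operators. Homogeneity turns the uniform
  estimate on the ball into an operator norm bound.\<close>

lemma finite_rank_approximation:
  assumes ap: "approximation_property smul"
    and A: "A \<in> compact_operators smul" "B \<in> compact_operators smul" and e: "e > 0"
  obtains F where "F \<in> finite_rank_operators smul"
    "norm ((F o\<^sub>L A) - A) \<le> e" "norm ((F o\<^sub>L B) - B) \<le> e"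
proof -
  have "compact (closure (A ` cball 0 1) \<union> closure (B ` cball 0 1))"
    using A by (intro compact_Un compact_operators_compact)
  then obtain F where F: "F \<in> finite_rank_operators smul"
    "\<And>x. x \<in> closure (A ` cball 0 1) \<union> closure (B ` cball 0 1) \<Longrightarrow> norm (F x - x) < e"
    using ap e unfolding approximation_property_def by meson
  have bound: "norm ((F o\<^sub>L C) - C) \<le> e"
    if C: "\<And>x. x \<in> C ` cball 0 1 \<Longrightarrow> norm (F x - x) < e" for C :: "'a \<Rightarrow>\<^sub>L 'a"
  proof (rule norm_blinfun_bound)
    show "0 \<le> e" using e by simp
    fix x :: 'a
    show "norm (((F o\<^sub>L C) - C) x) \<le> e * norm x"
    proof (cases "x = 0")
      case False
      have "x /\<^sub>R norm x \<in> cball 0 1" using False by simp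
      then have "norm (F (C (x /\<^sub>R norm x)) - C (x /\<^sub>R norm x)) < e" using C by blast
      moreover have "F (C (x /\<^sub>R norm x)) - C (x /\<^sub>R norm x) = (F (C x) - C x) /\<^sub>R norm x"
        by (simp add: blinfun.scaleR_right scaleR_diff_right)
      ultimately have "norm (F (C x) - C x) / norm x < e"
        by (simp add: divide_inverse mult.commute)
      then show ?thesis using False by (simp add: blinfun.diff_left field_simps)
    qed simp
  qed
  show ?thesis
  proof (rule that[OF F(1)]; rule bound)
    show "norm (F x - x) < e" if "x \<in> A ` cball 0 1" for x
      using that closure_subset[of "A ` cball 0 1"] by (intro F(2)) (rule UnI1, rule subsetD)
    show "norm (F x - x) < e" if "x \<in> B ` cball 0 1" for x
      using that closure_subset[of "B ` cball 0 1"] by (intro F(2)) (rule UnI2, rule subsetD)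
  qed
qed

lemma ex_factorization_near:
  assumes ap: "approximation_property smul"
    and a: "a \<in> compact_operators smul" and w: "w \<in> compact_operators smul"
    and d: "d > 0" and e: "e > 0"
  obtains a' c where "a' \<in> compact_operators smul" "c \<in> compact_operators smul"
    "dist a' a < d" "dist (a' o\<^sub>L c) w < e"
proof -
  obtain F0 where F0: "F0 \<in> finite_rank_operators smul" "norm ((F0 o\<^sub>L a) - a) \<le> d / 4"
    using finite_rank_approximation[OF ap a a, of "d / 4"] d by auto
  define a0 where "a0 = F0 o\<^sub>L a"
  have a0: "a0 \<in> finite_rank_operators smul" unfolding a0_def
    using F0(1) compact_operators_bounded[OF a] by (rule finite_rank_compose)
  obtain F where F: "F \<in> finite_rank_operators smul"
    and Fa: "norm ((F o\<^sub>L a0) - a0) \<le> min (d / 4) (e / 2)"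
    and Fw: "norm ((F o\<^sub>L w) - w) \<le> min (d / 4) (e / 2)"
    by (rule finite_rank_approximation[OF ap finite_rank_imp_compact[OF a0] w, of "min (d / 4) (e / 2)"])
      (use d e in simp)
  \<comment> \<open>Chosen so that \<open>norm (t *\<^sub>R F) \<le> d / 4\<close> whenever
    \<open>0 < t < r\<close>.\<close>
  define r where "r = d / (4 * (norm F + 1))"
  have nF: "norm F + 1 > 0" using norm_ge_zero[of F] by linarith
  have r: "r > 0" unfolding r_def using d nF by simp
  \<comment> \<open>Infinitely many small scalars are available and only finitely many are
    exceptional for \<open>a0\<close>.\<close>
  have "infinite (of_real ` {0<..<r} :: 'k set)"
    using r by (simp add: finite_image_iff inj_on_def infinite_Ioo)
  then obtain t where t: "t \<in> {0<..<r}"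
    and "of_real t \<notin> {z. \<not> (\<exists>R\<in>bounded_operators smul. \<forall>x. a0 (R x) - smul z (R x) = x)}"
    using finite_no_right_inverse[OF a0] by (meson finite_subset image_subsetI)
  then obtain R where R: "R \<in> bounded_operators smul" "\<And>x. a0 (R x) - smul (of_real t) (R x) = x"
    by auto
  define L where "L = a0 - blinfun_scale smul (of_real t) id_blinfun"
  have "L \<in> bounded_operators smul" unfolding L_def
    using a0 by (intro bounded_operators_diff bounded_operators_scale bounded_operators_id)
      (simp add: finite_rank_operators_def)
  have "F o\<^sub>L L \<in> compact_operators smul"
    by (intro compact_operators_compose_right finite_rank_imp_compact F \<open>L \<in> bounded_operators smul\<close>)
  moreover have "R o\<^sub>L w \<in> compact_operators smul"
    using R(1) w by (rule compact_operators_compose_left)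
  moreover have "dist (F o\<^sub>L L) a < d"
  proof -
    \<comment> \<open>Each of the three terms has norm at most \<open>d / 4\<close>, which leaves
      the total strictly below \<open>d\<close>.\<close>
    have decomp: "(F o\<^sub>L L) - a = ((F o\<^sub>L a0) - a0) + (a0 - a) - t *\<^sub>R F"
      by (rule blinfun_eqI) (simp add: L_def blinfun.diff_left blinfun.diff_right blinfun.add_left
          blinfun_scale_apply scale_of_real blinfun.scaleR_left blinfun.scaleR_right)
    have "norm ((F o\<^sub>L L) - a) \<le> norm ((F o\<^sub>L a0) - a0) + norm (a0 - a) + norm (t *\<^sub>R F)"
      unfolding decomp
      using norm_triangle_ineq4[of "((F o\<^sub>L a0) - a0) + (a0 - a)" "t *\<^sub>R F"]
        norm_triangle_ineq[of "(F o\<^sub>L a0) - a0" "a0 - a"] by linarith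
    moreover have "norm (t *\<^sub>R F) \<le> r * (norm F + 1)"
      using t by (auto intro!: mult_mono)
    moreover have "r * (norm F + 1) = d / 4" unfolding r_def using nF by (simp add: field_simps del: distrib_left_numeral)
    ultimately show ?thesis
      using F0(2) Fa d by (simp add: dist_norm a0_def)
  qed
  \<comment> \<open>The factor \<open>L\<close> cancels against its right inverse
    \<open>R\<close>.\<close>
  moreover have "(F o\<^sub>L L) o\<^sub>L (R o\<^sub>L w) = F o\<^sub>L w"
    by (rule blinfun_eqI) (simp add: L_def blinfun.diff_left blinfun_scale_apply R(2))
  then have "dist ((F o\<^sub>L L) o\<^sub>L (R o\<^sub>L w)) w < e"
    using Fw e by (simp add: dist_norm)
  ultimately show ?thesis by (rule that)
qed

end

section \<open>Transitivity from a dense orbit\<close>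

theorem corollary4p2:
  fixes smul :: "'k::{real_normed_field,euclidean_space} \<Rightarrow> 'a::banach \<Rightarrow> 'a"
    and T :: "('a \<Rightarrow>\<^sub>L 'a) \<Rightarrow> ('a \<Rightarrow>\<^sub>L 'a)"
  assumes "banach_space_over smul"
    and "separable_space (euclidean :: 'a topology)"
    and "approximation_property smul"
    and "bounded_operator_on (blinfun_scale smul) (compact_operators smul) T"
    and "hypercyclic_on (compact_operators smul) T"
  shows "generalized_numerically_transitive (o\<^sub>L) (compact_operators smul) T"
proof -
  interpret banach_space_over smul by fact
  let ?K = "compact_operators smul"
  have TK: "(T ^^ n) x \<in> ?K" if "x \<in> ?K" for n x
    using that assms(4) by (induction n) (auto simp: bounded_operator_on_def)
  have orbit: "{(T ^^ n) y | n. n \<ge> 0} = range (\<lambda>n. (T ^^ n) y)" for y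
    unfolding full_SetCompr_eq[symmetric] by simp
  obtain y where y: "y \<in> ?K" "?K \<subseteq> closure (range (\<lambda>n. (T ^^ n) y))"
    using assms(5) unfolding hypercyclic_on_def orbit by blast
  \<comment> \<open>Density alone gives some iterate near \<open>c\<close>; one after time
    \<open>m\<close> is needed so that \<open>k - m\<close> is positive.\<close>
  have later_iterate: "\<exists>k>m. dist ((T ^^ k) y) c < e" if "c \<in> ?K" "e > 0" for c e m
  proof (cases "?K = {0}")
    \<comment> \<open>The zero space has no limit points, but there every iterate equals
      \<open>c\<close>.\<close>
    case True
    then have "(T ^^ Suc m) y = c"
      using TK[OF y(1), of "Suc m"] that(1) by (simp only: singleton_iff)
    then show ?thesis using that(2) by (intro exI[of _ "Suc m"]) auto
  next
    case False
    then obtain D where "D \<in> ?K" "D \<noteq> 0" using y(1) by blast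
    then have "c islimpt ?K" using islimpt_compact_operators that(1) by blast
    then have "c islimpt range (\<lambda>n. (T ^^ n) y)"
      using islimpt_subset[OF _ y(2)] by (simp only: limpt_of_closure)
    \<comment> \<open>The iterates up to time \<open>m\<close> form a finite set, and discarding it
      preserves limit points.\<close>
    also have "range (\<lambda>n. (T ^^ n) y) = (\<lambda>n. (T ^^ n) y) ` {..m} \<union> (\<lambda>n. (T ^^ n) y) ` {m<..}"
      unfolding image_Un[symmetric] by (rule arg_cong) auto
    finally have "c islimpt (\<lambda>n. (T ^^ n) y) ` {m<..}"
      by (simp add: islimpt_Un_finite)
    then show ?thesis using that(2) by (force simp: islimpt_approachable)
  qed
  show ?thesis
    unfolding generalized_numerically_transitive_def
  proof (intro allI impI, elim conjE)
    fix V W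
    assume V: "openin (prod_topology (top_of_set ?K) (top_of_set ?K)) V" "V \<noteq> {}"
      and W: "openin (top_of_set ?K) W" "W \<noteq> {}"
    obtain a b where "(a, b) \<in> V" using V(2) by auto
    then obtain V1 V2 where V12: "openin (top_of_set ?K) V1" "openin (top_of_set ?K) V2"
      "a \<in> V1" "b \<in> V2" "V1 \<times> V2 \<subseteq> V"
      using V(1) unfolding openin_prod_topology_alt by meson
    obtain w where w: "w \<in> W" using W(2) by auto
    obtain d1 where d1: "d1 > 0" "\<And>x. x \<in> ?K \<Longrightarrow> dist x a < d1 \<Longrightarrow> x \<in> V1" and a: "a \<in> ?K"
      using V12(1,3) unfolding openin_euclidean_subtopology_iff by blast
    obtain d2 where d2: "d2 > 0" "\<And>x. x \<in> ?K \<Longrightarrow> dist x b < d2 \<Longrightarrow> x \<in> V2" and b: "b \<in> ?K"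
      using V12(2,4) unfolding openin_euclidean_subtopology_iff by blast
    obtain e where e: "e > 0" "\<And>x. x \<in> ?K \<Longrightarrow> dist x w < e \<Longrightarrow> x \<in> W" and wK: "w \<in> ?K"
      using W(1) w unfolding openin_euclidean_subtopology_iff by blast
    obtain a' c where a': "a' \<in> ?K" "dist a' a < d1" and c: "c \<in> ?K"
      and ac: "dist (a' o\<^sub>L c) w < e / 2"
      using ex_factorization_near[OF assms(3) a wK d1(1) half_gt_zero[OF e(1)]] by metis
    obtain m where m: "dist ((T ^^ m) y) b < d2" using later_iterate[OF b d2(1)] by blast
    have na: "norm a' + 1 > 0" using norm_ge_zero[of a'] by linarith
    \<comment> \<open>The operator \<open>a'\<close> is already fixed, so the tolerance can absorb
      its norm: composing with \<open>a'\<close> costs at most \<open>e / 2\<close>.\<close>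
    obtain k where k: "k > m" "dist ((T ^^ k) y) c < e / (2 * (norm a' + 1))"
      using later_iterate[OF c, of "e / (2 * (norm a' + 1))" m] e(1) na
      by (metis divide_pos_pos mult_pos_pos zero_less_numeral)
    define n where "n = k - m"
    have n: "n \<ge> 1" "k = n + m" using k(1) unfolding n_def by auto
    have "a' o\<^sub>L (T ^^ k) y \<in> W"
    proof (rule e(2))
      show "a' o\<^sub>L (T ^^ k) y \<in> ?K"
        using a'(1) TK[OF y(1)] by (intro compact_operators_compose_left compact_operators_bounded)
      have "(a' o\<^sub>L (T ^^ k) y) - (a' o\<^sub>L c) = a' o\<^sub>L ((T ^^ k) y - c)"
        by (rule blinfun_eqI) (simp add: blinfun.diff_left blinfun.diff_right)
      then have "dist (a' o\<^sub>L (T ^^ k) y) (a' o\<^sub>L c) \<le> norm a' * dist ((T ^^ k) y) c"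
        by (simp add: dist_norm norm_blinfun_compose)
      also have "\<dots> \<le> (norm a' + 1) * (e / (2 * (norm a' + 1)))"
        using k(2) na by (intro mult_mono) auto
      also have "\<dots> = e / 2" using na by (simp add: field_simps del: distrib_left_numeral)
      finally show "dist (a' o\<^sub>L (T ^^ k) y) w < e"
        using ac dist_triangle[of "a' o\<^sub>L (T ^^ k) y" w "a' o\<^sub>L c"] by linarith
    qed
    moreover have "(a', (T ^^ m) y) \<in> V"
      using V12(5) d1(2)[OF a'] d2(2)[OF TK[OF y(1)] m] by blast
    \<comment> \<open>With \<open>b\<close> replaced by the nearby iterate at time \<open>m\<close>,
      another \<open>n\<close> applications of \<open>T\<close> lead to time
      \<open>k\<close>.\<close>
    moreover have "Theta (o\<^sub>L) T n (a', (T ^^ m) y) = a' o\<^sub>L (T ^^ k) y"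
      by (simp add: Theta_def n(2) funpow_add)
    ultimately have "Theta (o\<^sub>L) T n (a', (T ^^ m) y) \<in> Theta (o\<^sub>L) T n ` V \<inter> W"
      by (metis IntI imageI)
    then show "\<exists>n\<ge>1. Theta (o\<^sub>L) T n ` V \<inter> W \<noteq> {}"
      using n(1) by blast
  qed
qed

end
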